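(* Let $q$ be a prime power and for $n\geq 1$ let $d_n$ be the number of $n \times n$ projective derangements over $\mathbf{F}_q$. Then $$1 + \sum_{n \geq 1} \frac{d_n}{\gamma_n}u^n = \frac{1}{1-u}\, \prod_{r \geq 1} \left(1- \frac{u}{q^r} \right)^{q-1}.$$
   Context: $\mathbf{F}_q$ is the field with $q$ elements. $\gamma_n=|\mathrm{GL}_n(q)|=(q^n-1)(q^n-q)\cdots(q^n-q^{n-1})$ is the order of the group of invertible $n\times n$ matrices over $\mathbf{F}_q$. A square matrix over $\mathbf{F}_q$ is a projective derangement if the induced map on projective space has no fixed points; equivalently, the matrix has no eigenvalues in $\mathbf{F}_q$ (in particular it is invertible). The identity is one of formal power series in $u$ with real coefficients, the infinite product being taken as a coefficientwise limit. *)

theory Defs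
  imports
    "Jordan_Normal_Form.Char_Poly"
    "HOL-Computational_Algebra.Formal_Power_Series"
    "HOL-Library.Cardinality"
begin

definition line :: "'a::field vec \<Rightarrow> 'a vec set" where
  "line v = {c \<cdot>\<^sub>v v | c. True}"

definition projective_space :: "nat \<Rightarrow> 'a::field vec set set" where
  "projective_space n = {line v | v. v \<in> carrier_vec n \<and> v \<noteq> 0\<^sub>v n}"

definition GL :: "nat \<Rightarrow> 'a::field mat set" where
  "GL n = {A \<in> carrier_mat n n. invertible_mat A}"

(* Invertibility is what makes A induce a (total) map l \<mapsto> A l on projective space. *)
definition projective_derangements :: "nat \<Rightarrow> 'a::field mat set" where
  "projective_derangements n =
     {A \<in> GL n. \<forall>l \<in> projective_space n. (\<lambda>v. A *\<^sub>v v) ` l \<noteq> l}"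

(* Coefficientwise convergence in the topology of the reals. This is weaker than convergence in
   the metric on type fps, for which each coefficient would have to be eventually constant. *)
definition fps_has_prod_coeffwise :: "(nat \<Rightarrow> real fps) \<Rightarrow> real fps \<Rightarrow> bool" where
  "fps_has_prod_coeffwise f P \<longleftrightarrow>
     (\<forall>n. (\<lambda>N. fps_nth (\<Prod>r=1..N. f r) n) \<longlonglongrightarrow> fps_nth P n)"

lemma finite_carrier_mat: "finite (carrier_mat m n :: 'a::finite mat set)"
proof (rule finite_subset)
  let ?I = "{..<m} \<times> {..<n}"
  let ?F = "PiE ?I (\<lambda>_. UNIV :: 'a set)"
  show "finite ((\<lambda>f. mat m n f) ` ?F)"
    by (intro finite_imageI finite_PiE) auto
  show "carrier_mat m n \<subseteq> (\<lambda>f. mat m n f) ` ?F"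
  proof
    fix A :: "'a mat" assume A: "A \<in> carrier_mat m n"
    have "A = mat m n (restrict (\<lambda>ij. A $$ ij) ?I)"
      using A by (intro eq_matI) auto
    moreover have "restrict (\<lambda>ij. A $$ ij) ?I \<in> ?F" by auto
    ultimately show "A \<in> (\<lambda>f. mat m n f) ` ?F" by blast
  qed
qed

lemma mem_GL_iff_det:
  fixes A :: "'a::field mat"
  assumes A: "A \<in> carrier_mat n n"
  shows "A \<in> GL n \<longleftrightarrow> det A \<noteq> 0"
proof
  assume "A \<in> GL n"
  then obtain B where AB: "A * B = 1\<^sub>m n" and BA: "B * A = 1\<^sub>m (dim_row B)"
    using A by (auto simp: GL_def invertible_mat_def inverts_mat_def)
  have "dim_col B = n" using arg_cong[OF AB, of dim_col] by simp
  moreover have "dim_row B = n" using arg_cong[OF BA, of dim_col] A by simp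
  ultimately have "B \<in> carrier_mat n n" by auto
  then have "det A * det B = 1" using det_mult[OF A, of B] AB by simp
  then show "det A \<noteq> 0" by auto
next
  assume "det A \<noteq> 0"
  from det_non_zero_imp_unit[OF A this, of "()"]
  obtain B where "B \<in> carrier_mat n n" "B * A = 1\<^sub>m n" "A * B = 1\<^sub>m n"
    by (auto simp: Units_def ring_mat_def)
  then show "A \<in> GL n" using A
    by (auto simp: GL_def invertible_mat_def inverts_mat_def square_mat.simps intro!: exI[of _ B])
qed

lemma mem_projective_derangements_iff:
  fixes A :: "'a::field mat"
  assumes A: "A \<in> carrier_mat n n"
  shows "A \<in> projective_derangements n \<longleftrightarrow> \<not> (\<exists>k. eigenvalue A k)"
proof
  assume pd: "A \<in> projective_derangements n"
  show "\<not> (\<exists>k. eigenvalue A k)"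
  proof
    assume "\<exists>k. eigenvalue A k"
    then obtain v k where v: "v \<in> carrier_vec n" "v \<noteq> 0\<^sub>v n" and Av: "A *\<^sub>v v = k \<cdot>\<^sub>v v"
      using A by (auto simp: eigenvalue_def eigenvector_def)
    have "det A \<noteq> 0" using pd mem_GL_iff_det[OF A] by (auto simp: projective_derangements_def)
    then have "A *\<^sub>v v \<noteq> 0\<^sub>v n" using v det_0_iff_vec_prod_zero_field[OF A] by auto
    moreover have "0 \<cdot>\<^sub>v v = 0\<^sub>v n" using v by auto
    ultimately have k: "k \<noteq> 0" using Av by metis
    have Ac: "A *\<^sub>v (c \<cdot>\<^sub>v v) = (c * k) \<cdot>\<^sub>v v" for c
      using mult_mat_vec[OF A v(1)] Av by (simp add: smult_smult_assoc)
    have "(\<lambda>v. A *\<^sub>v v) ` line v = line v"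
    proof (intro equalityI subsetI)
      fix w assume "w \<in> (\<lambda>v. A *\<^sub>v v) ` line v"
      then show "w \<in> line v" by (auto simp: line_def Ac)
    next
      fix w assume "w \<in> line v"
      then obtain c where "w = c \<cdot>\<^sub>v v" by (auto simp: line_def)
      then have "w = A *\<^sub>v ((c / k) \<cdot>\<^sub>v v)" using k by (simp add: Ac)
      then show "w \<in> (\<lambda>v. A *\<^sub>v v) ` line v" by (auto simp: line_def)
    qed
    then show False using pd v by (auto simp: projective_derangements_def projective_space_def)
  qed
next
  assume ne: "\<not> (\<exists>k. eigenvalue A k)"
  have nev: "A *\<^sub>v v \<noteq> k \<cdot>\<^sub>v v" if "v \<in> carrier_vec n" "v \<noteq> 0\<^sub>v n" for v k
    using ne that A by (auto simp: eigenvalue_def eigenvector_def)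
  have "A *\<^sub>v v \<noteq> 0\<^sub>v n" if v: "v \<in> carrier_vec n" "v \<noteq> 0\<^sub>v n" for v
  proof -
    have "0 \<cdot>\<^sub>v v = 0\<^sub>v n" using v by auto
    then show ?thesis using nev[OF v, of 0] by simp
  qed
  then have "A \<in> GL n"
    using mem_GL_iff_det[OF A] det_0_iff_vec_prod_zero_field[OF A] by blast
  moreover have "(\<lambda>v. A *\<^sub>v v) ` line v \<noteq> line v"
    if v: "v \<in> carrier_vec n" "v \<noteq> 0\<^sub>v n" for v
  proof
    assume eq: "(\<lambda>v. A *\<^sub>v v) ` line v = line v"
    have "v = 1 \<cdot>\<^sub>v v" by simp
    then have "v \<in> line v" unfolding line_def by blast
    then have "A *\<^sub>v v \<in> line v" using eq by blast
    then show False using nev[OF v] by (auto simp: line_def)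
  qed
  ultimately show "A \<in> projective_derangements n"
    by (auto simp: projective_derangements_def projective_space_def)
qed

end

theory Submission
  imports Defs
begin

text \<open>
Let \<open>a_S(n)\<close> be the number of \<open>n \<times> n\<close> matrices without eigenvalues in \<open>S\<close>, and let \<open>F_S(u)\<close> be the
series with coefficients \<open>a_S(n) / \<gamma>_n\<close>. The wanted series is \<open>F_S\<close> for \<open>S\<close> the whole field. The point
is that excluding one more eigenvalue multiplies \<open>F_S\<close> by a series \<open>W\<close> that depends neither on \<open>S\<close> nor
on the eigenvalue (lemma \<open>eigenvalue_free_gf_insert\<close>). Hence \<open>F_S = W ^ card S * F\<close>, where \<open>F\<close> is the
series of all matrices.

To obtain \<open>W\<close>, count the independent \<open>k\<close>-tuples of eigenvectors for \<open>l\<close>, summed over all matrices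
without eigenvalues in \<open>S\<close>. If \<open>l\<close> is not in \<open>S\<close>, then the block form of a matrix with \<open>k\<close> prescribed
eigenvectors gives \<open>\<gamma>_n a_S(n - k) / \<gamma>_(n - k)\<close> for this sum (lemma \<open>sum_q_falling_eigenspace\<close>). A matrix
whose eigenspace has \<open>q ^ m\<close> elements contributes a number that depends only on \<open>m\<close> and \<open>k\<close> and is zero
for \<open>k > m\<close>. So universal weights, the coefficients of \<open>W\<close>, combine these numbers to the indicator of
\<open>m = 0\<close>, that is, of \<open>l\<close> not being an eigenvalue.

The series \<open>W\<close> is then found without computing its coefficients. Excluding the eigenvalue zero leaves
the invertible matrices, whose series is \<open>1 / (1 - u)\<close>; so \<open>W F = 1 / (1 - u)\<close>, and excluding all \<open>q\<close>
elements of the field gives \<open>W ^ q * F = W ^ (q - 1) / (1 - u)\<close>. The explicit coefficients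
\<open>q ^ (n * n) / \<gamma>_n\<close> of \<open>F\<close> yield \<open>(1 - u) F(u) = F(u/q)\<close>. This translates into
\<open>W(u) = (1 - u/q) W(u/q)\<close>, and iterating it shows that \<open>W\<close> is the product of all \<open>1 - u/q ^ r\<close>.
\<close>

section \<open>Independent lists over a finite field\<close>

lemma card_carrier_mat:
  "card (carrier_mat m n :: 'a::finite mat set) = CARD('a) ^ (m * n)"
proof -
  let ?F = "PiE ({..<m} \<times> {..<n}) (\<lambda>_. UNIV :: 'a set)"
  have "bij_betw (mat m n) ?F (carrier_mat m n)"
  proof (rule bij_betw_byWitness[where f' = "\<lambda>A. restrict (\<lambda>ij. A $$ ij) ({..<m} \<times> {..<n})"])
    show "\<forall>f\<in>?F. restrict (\<lambda>ij. mat m n f $$ ij) ({..<m} \<times> {..<n}) = f"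
      by (auto simp: fun_eq_iff PiE_def extensional_def restrict_def)
    show "\<forall>A\<in>carrier_mat m n. mat m n (restrict (\<lambda>ij. A $$ ij) ({..<m} \<times> {..<n})) = A"
      by (auto intro!: eq_matI)
  qed (auto split: if_splits)
  then have "card (carrier_mat m n :: 'a mat set) = card ?F"
    by (simp add: bij_betw_same_card)
  then show ?thesis by (simp add: card_PiE card_cartesian_product)
qed

lemma card_carrier_vec:
  "card (carrier_vec n :: 'a::finite vec set) = CARD('a) ^ n"
proof -
  let ?F = "PiE {..<n} (\<lambda>_. UNIV :: 'a set)"
  have "bij_betw (vec n) ?F (carrier_vec n)"
  proof (rule bij_betw_byWitness[where f' = "\<lambda>v. restrict (\<lambda>i. v $ i) {..<n}"])
    show "\<forall>f\<in>?F. restrict (\<lambda>i. vec n f $ i) {..<n} = f"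
      by (auto simp: fun_eq_iff PiE_def extensional_def restrict_def)
    show "\<forall>v\<in>carrier_vec n. vec n (restrict (\<lambda>i. v $ i) {..<n}) = v"
      by (auto intro!: eq_vecI)
    show "vec n ` ?F \<subseteq> carrier_vec n" by (simp add: image_subset_iff)
    show "(\<lambda>v. restrict (\<lambda>i. v $ i) {..<n}) ` carrier_vec n \<subseteq> ?F"
      unfolding image_subset_iff by simp
  qed
  then have "card (carrier_vec n :: 'a vec set) = card ?F"
    by (simp add: bij_betw_same_card)
  then show ?thesis by (simp add: card_PiE)
qed

lemma finite_carrier_vec: "finite (carrier_vec n :: 'a::finite vec set)"
  by (rule card_ge_0_finite) (simp add: card_carrier_vec)

lemma one_less_card_field: "1 < real CARD('a::{field,finite})"
  using card_mono[of UNIV "{0, 1 :: 'a}"] by simp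

definition independent_vecs :: "nat \<Rightarrow> 'a::field vec list \<Rightarrow> bool" where
  "independent_vecs n vs \<longleftrightarrow> set vs \<subseteq> carrier_vec n \<and>
     (\<forall>c\<in>carrier_vec (length vs). mat_of_cols n vs *\<^sub>v c = 0\<^sub>v n \<longrightarrow> c = 0\<^sub>v (length vs))"

definition vec_span :: "nat \<Rightarrow> 'a::field vec list \<Rightarrow> 'a vec set" where
  "vec_span n vs = (\<lambda>c. mat_of_cols n vs *\<^sub>v c) ` carrier_vec (length vs)"

definition vec_subspace :: "nat \<Rightarrow> 'a::field vec set \<Rightarrow> bool" where
  "vec_subspace n U \<longleftrightarrow> U \<subseteq> carrier_vec n \<and> 0\<^sub>v n \<in> U \<and>
     (\<forall>v\<in>U. \<forall>w\<in>U. v + w \<in> U) \<and> (\<forall>a. \<forall>v\<in>U. a \<cdot>\<^sub>v v \<in> U)"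

text \<open>Allowing the set to vary with the position is what makes it possible to prescribe a subspace
for some of the columns of an invertible matrix and nothing for the others.\<close>
definition frames :: "nat \<Rightarrow> (nat \<Rightarrow> 'a::field vec set) \<Rightarrow> nat \<Rightarrow> 'a vec list set" where
  "frames n U k = {vs. independent_vecs n vs \<and> length vs = k \<and> (\<forall>i<k. vs ! i \<in> U i)}"

lemma mat_of_cols_snoc_mult:
  fixes c :: "'a::field vec"
  assumes c: "c \<in> carrier_vec (Suc (length vs))" and v: "v \<in> carrier_vec n"
  shows "mat_of_cols n (vs @ [v]) *\<^sub>v c =
         mat_of_cols n vs *\<^sub>v vec_first c (length vs) + c $ length vs \<cdot>\<^sub>v v"
proof (rule eq_vecI)
  fix i assume "i < dim_vec (mat_of_cols n vs *\<^sub>v vec_first c (length vs) + c $ length vs \<cdot>\<^sub>v v)"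
  then have i: "i < n" using v by simp
  then have "(mat_of_cols n (vs @ [v]) *\<^sub>v c) $ i =
        (\<Sum>j<Suc (length vs). (vs @ [v]) ! j $ i * c $ j)"
    using c by (simp add: scalar_prod_def mat_of_cols_index lessThan_atLeast0)
  also have "\<dots> = (\<Sum>j<length vs. vs ! j $ i * c $ j) + v $ i * c $ length vs"
    by (simp add: nth_append)
  finally have "(mat_of_cols n (vs @ [v]) *\<^sub>v c) $ i =
      (\<Sum>j<length vs. vs ! j $ i * c $ j) + v $ i * c $ length vs" .
  moreover have "(mat_of_cols n vs *\<^sub>v vec_first c (length vs) + c $ length vs \<cdot>\<^sub>v v) $ i =
      (\<Sum>j<length vs. vs ! j $ i * c $ j) + v $ i * c $ length vs"
    using i c v
    by (simp add: scalar_prod_def mat_of_cols_index lessThan_atLeast0 vec_first_def mult.commute)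
  ultimately show "(mat_of_cols n (vs @ [v]) *\<^sub>v c) $ i =
      (mat_of_cols n vs *\<^sub>v vec_first c (length vs) + c $ length vs \<cdot>\<^sub>v v) $ i"
    by (rule trans[OF _ sym])
qed (use v in simp)

lemma independent_vecs_Nil: "independent_vecs n []"
  by (auto simp: independent_vecs_def)

lemma independent_vecs_snoc:
  assumes v: "v \<in> carrier_vec n"
  shows "independent_vecs n (vs @ [v]) \<longleftrightarrow> independent_vecs n vs \<and> v \<notin> vec_span n vs"
proof (cases "set vs \<subseteq> carrier_vec n")
  case False
  then show ?thesis by (auto simp: independent_vecs_def)
next
  case True
  let ?k = "length vs"
  let ?M = "mat_of_cols n vs"
  have M: "?M \<in> carrier_mat n ?k" by simp
  show ?thesis
  proof (intro iffI conjI)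
    assume ind: "independent_vecs n (vs @ [v])"
    have zero: "c = 0\<^sub>v (Suc ?k)"
      if "c \<in> carrier_vec (Suc ?k)" "mat_of_cols n (vs @ [v]) *\<^sub>v c = 0\<^sub>v n" for c
      using ind that by (auto simp: independent_vecs_def)
    have ext: "mat_of_cols n (vs @ [v]) *\<^sub>v (vec (Suc ?k) (\<lambda>i. if i < ?k then c $ i else a))
               = ?M *\<^sub>v c + a \<cdot>\<^sub>v v" if "c \<in> carrier_vec ?k" for c a
    proof -
      have "vec_first (vec (Suc ?k) (\<lambda>i. if i < ?k then c $ i else a)) ?k = c"
        using that by (auto simp: vec_first_def intro!: eq_vecI)
      then show ?thesis using v by (simp add: mat_of_cols_snoc_mult)
    qed
    show "independent_vecs n vs"
      unfolding independent_vecs_def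
    proof (intro conjI ballI impI True)
      fix c assume c: "c \<in> carrier_vec ?k" "?M *\<^sub>v c = 0\<^sub>v n"
      have z: "0 \<cdot>\<^sub>v v = 0\<^sub>v n" using v by auto
      have "vec (Suc ?k) (\<lambda>i. if i < ?k then c $ i else 0) = 0\<^sub>v (Suc ?k)"
        by (rule zero) (use c z in \<open>auto simp: ext\<close>)
      then have "(vec (Suc ?k) (\<lambda>i. if i < ?k then c $ i else 0)) $ i = 0" if "i < Suc ?k" for i
        using that by simp
      note e = this
      show "c = 0\<^sub>v ?k"
      proof (rule eq_vecI)
        fix i assume "i < dim_vec (0\<^sub>v ?k)"
        then show "c $ i = 0\<^sub>v ?k $ i" using e[of i] by simp
      qed (use c in simp)
    qed
    show "v \<notin> vec_span n vs"
    proof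
      assume "v \<in> vec_span n vs"
      then obtain c where c: "c \<in> carrier_vec ?k" "v = ?M *\<^sub>v c" by (auto simp: vec_span_def)
      have "?M *\<^sub>v c + (-1) \<cdot>\<^sub>v v = 0\<^sub>v n"
        using v c(2)[symmetric] by (auto intro!: eq_vecI)
      then have "vec (Suc ?k) (\<lambda>i. if i < ?k then c $ i else -1) = 0\<^sub>v (Suc ?k)"
        using ext[OF c(1), of "-1"] by (intro zero) simp_all
      then have "(vec (Suc ?k) (\<lambda>i. if i < ?k then c $ i else -1)) $ ?k = 0"
        by (metis index_zero_vec(1) lessI)
      then show False by simp
    qed
  next
    assume *: "independent_vecs n vs \<and> v \<notin> vec_span n vs"
    show "independent_vecs n (vs @ [v])"
      unfolding independent_vecs_def
    proof (intro conjI ballI impI)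
      show "set (vs @ [v]) \<subseteq> carrier_vec n" using True v by simp
      fix c assume c0: "c \<in> carrier_vec (length (vs @ [v]))"
        and "mat_of_cols n (vs @ [v]) *\<^sub>v c = 0\<^sub>v n"
      then have c: "c \<in> carrier_vec (Suc ?k)"
        and eq: "?M *\<^sub>v vec_first c ?k + c $ ?k \<cdot>\<^sub>v v = 0\<^sub>v n"
        using v by (auto simp: mat_of_cols_snoc_mult)
      let ?f = "vec_first c ?k"
      have f: "?f \<in> carrier_vec ?k" by simp
      have eqi: "(?M *\<^sub>v ?f) $ i + c $ ?k * v $ i = 0" if "i < n" for i
        using arg_cong[OF eq, of "\<lambda>w. w $ i"] that v by simp
      have ck: "c $ ?k = 0"
      proof (rule ccontr)
        assume nz: "c $ ?k \<noteq> 0"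
        have "v = ?M *\<^sub>v ((- (1 / c $ ?k)) \<cdot>\<^sub>v ?f)"
          unfolding mult_mat_vec[OF M f]
        proof (rule eq_vecI)
          fix i assume "i < dim_vec ((- (1 / c $ ?k)) \<cdot>\<^sub>v (?M *\<^sub>v ?f))"
          then have i: "i < n" by simp
          then have "(?M *\<^sub>v ?f) $ i = - (c $ ?k * v $ i)" using eqi[OF i] by (simp add: eq_neg_iff_add_eq_0)
          then show "v $ i = ((- (1 / c $ ?k)) \<cdot>\<^sub>v (?M *\<^sub>v ?f)) $ i"
            using i nz by (simp del: index_mult_mat_vec)
        qed (use v in simp)
        then have "v \<in> vec_span n vs" unfolding vec_span_def by (rule image_eqI) simp
        then show False using * by blast
      qed
      then have "?M *\<^sub>v ?f = 0\<^sub>v n"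
        using eqi by (intro eq_vecI) (auto simp del: index_mult_mat_vec)
      then have f0: "?f = 0\<^sub>v ?k" using * f by (auto simp: independent_vecs_def)
      show "c = 0\<^sub>v (length (vs @ [v]))"
      proof (rule eq_vecI)
        fix i assume "i < dim_vec (0\<^sub>v (length (vs @ [v])) :: 'a vec)"
        then have "i < Suc ?k" by simp
        moreover have "c $ i = 0" if "i < ?k"
          using arg_cong[OF f0, of "\<lambda>w. w $ i"] that c by (simp add: vec_first_def)
        ultimately show "c $ i = 0\<^sub>v (length (vs @ [v])) $ i"
          using ck by (auto simp: less_Suc_eq)
      qed (use c in simp)
    qed
  qed
qed

lemma vec_span_subset:
  assumes "vec_subspace n U" "set vs \<subseteq> U"
  shows "vec_span n vs \<subseteq> U"
  using assms(2)
proof (induction vs rule: rev_induct)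
  case Nil
  have "mat_of_cols n [] *\<^sub>v c = 0\<^sub>v n" if "c \<in> carrier_vec 0" for c :: "'a vec"
    using that by (intro eq_vecI) (auto simp: scalar_prod_def)
  then show ?case using assms(1) by (auto simp: vec_span_def vec_subspace_def)
next
  case (snoc v vs)
  then have v: "v \<in> U" "v \<in> carrier_vec n" using assms(1) by (auto simp: vec_subspace_def)
  show ?case
  proof
    fix w assume "w \<in> vec_span n (vs @ [v])"
    then obtain c where c: "c \<in> carrier_vec (Suc (length vs))"
      and w: "w = mat_of_cols n (vs @ [v]) *\<^sub>v c" by (auto simp: vec_span_def)
    have "mat_of_cols n vs *\<^sub>v vec_first c (length vs) \<in> vec_span n vs"
      by (auto simp: vec_span_def)
    then have "mat_of_cols n vs *\<^sub>v vec_first c (length vs) \<in> U" using snoc by auto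
    then show "w \<in> U"
      using assms(1) v w c by (auto simp: mat_of_cols_snoc_mult vec_subspace_def)
  qed
qed

text \<open>Independence says that the combination map is injective, so the span has as many
elements as there are coefficient vectors.\<close>
lemma card_vec_span:
  fixes vs :: "'a::{field,finite} vec list"
  assumes "independent_vecs n vs"
  shows "card (vec_span n vs) = CARD('a) ^ length vs"
proof -
  let ?M = "mat_of_cols n vs"
  have M: "?M \<in> carrier_mat n (length vs)" by simp
  have "inj_on (\<lambda>c. ?M *\<^sub>v c) (carrier_vec (length vs))"
  proof (rule inj_onI)
    fix c d assume cd: "c \<in> carrier_vec (length vs)" "d \<in> carrier_vec (length vs)"
      and eq: "?M *\<^sub>v c = ?M *\<^sub>v d"
    have "?M *\<^sub>v (c - d) = 0\<^sub>v n"
      using mult_minus_distrib_mat_vec[OF M cd] eq mult_mat_vec_carrier[OF M cd(2)] by simp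
    then have *: "c - d = 0\<^sub>v (length vs)"
      using assms cd by (simp add: independent_vecs_def)
    show "c = d"
    proof (rule eq_vecI)
      fix i assume "i < dim_vec d"
      then show "c $ i = d $ i" using arg_cong[OF *, of "\<lambda>w. w $ i"] cd by simp
    qed (use cd in simp)
  qed
  then show ?thesis by (simp add: vec_span_def card_image card_carrier_vec)
qed

text \<open>An independent list that has been chosen up to position \<open>k\<close> spans a set of \<open>q ^ k\<close> vectors,
which lies in \<open>U k\<close> by monotonicity; the next vector is any other element of \<open>U k\<close>. If some position
admits no choice, its factor is zero. The product is taken over the reals because later factors may
then be negative.\<close>
lemma card_frames:
  fixes U :: "nat \<Rightarrow> 'a::{field,finite} vec set"
  assumes sub: "\<And>i. vec_subspace n (U i)"
    and mono: "\<And>i j. i \<le> j \<Longrightarrow> U i \<subseteq> U j"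
  shows "real (card (frames n U k)) = (\<Prod>i<k. real (card (U i)) - real CARD('a) ^ i)"
proof -
  have Uc: "U i \<subseteq> carrier_vec n" for i using sub by (auto simp: vec_subspace_def)
  have fU: "finite (U i)" for i using Uc finite_carrier_vec finite_subset by blast
  have "finite (frames n U k) \<and>
        real (card (frames n U k)) = (\<Prod>i<k. real (card (U i)) - real CARD('a) ^ i)"
  proof (induction k)
    case 0
    have "frames n U 0 = {[]}" by (auto simp: frames_def independent_vecs_Nil)
    then show ?case by simp
  next
    case (Suc k)
    have eq: "frames n U (Suc k) =
          (\<lambda>(vs, v). vs @ [v]) ` (SIGMA vs : frames n U k. U k - vec_span n vs)"
    proof (intro equalityI subsetI)
      fix ws assume ws: "ws \<in> frames n U (Suc k)"
      then have "length ws = Suc k" by (simp add: frames_def)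
      then obtain vs v where w: "ws = vs @ [v]" "length vs = k"
        by (metis length_append_singleton nat.inject length_Suc_conv_rev)
      have nth: "(vs @ [v]) ! i \<in> U i" if "i < Suc k" for i using ws w that by (auto simp: frames_def)
      have "v \<in> U k" using nth[of k] w by (simp add: nth_append)
      moreover have "vs ! i \<in> U i" if "i < k" for i
        using nth[of i] that w by (simp add: nth_append)
      moreover have "v \<in> carrier_vec n" using \<open>v \<in> U k\<close> Uc by blast
      moreover have "independent_vecs n (vs @ [v])" using ws w by (auto simp: frames_def)
      ultimately show "ws \<in> (\<lambda>(vs, v). vs @ [v]) ` (SIGMA vs : frames n U k. U k - vec_span n vs)"
        using w by (auto simp: frames_def independent_vecs_snoc)
    next
      fix ws assume "ws \<in> (\<lambda>(vs, v). vs @ [v]) ` (SIGMA vs : frames n U k. U k - vec_span n vs)"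
      then obtain vs v where w: "ws = vs @ [v]" "vs \<in> frames n U k" "v \<in> U k" "v \<notin> vec_span n vs"
        by auto
      moreover have "v \<in> carrier_vec n" using w Uc by blast
      ultimately show "ws \<in> frames n U (Suc k)"
        by (auto simp: frames_def independent_vecs_snoc nth_append less_Suc_eq)
    qed
    have inj: "inj_on (\<lambda>(vs, v). vs @ [v]) (SIGMA vs : frames n U k. U k - vec_span n vs)"
      by (auto simp: inj_on_def)
    have fib: "real (card (U k - vec_span n vs)) = real (card (U k)) - real CARD('a) ^ k"
      if vs: "vs \<in> frames n U k" for vs
    proof -
      have "set vs \<subseteq> U k"
      proof
        fix v assume "v \<in> set vs"
        then obtain i where "i < k" "v = vs ! i"
          using vs by (auto simp: frames_def in_set_conv_nth)
        then show "v \<in> U k" using vs mono[of i k] by (auto simp: frames_def)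
      qed
      then have s: "vec_span n vs \<subseteq> U k" using sub vec_span_subset by blast
      have c: "card (vec_span n vs) = CARD('a) ^ k"
        using vs card_vec_span by (auto simp: frames_def)
      have "finite (vec_span n vs)" using s fU finite_subset by blast
      then have "card (U k - vec_span n vs) = card (U k) - CARD('a) ^ k"
        using s c by (simp add: card_Diff_subset)
      moreover have "CARD('a) ^ k \<le> card (U k)" using c card_mono[OF fU s] by simp
      ultimately show ?thesis by (simp add: of_nat_diff)
    qed
    have fin: "finite (frames n U (Suc k))"
      unfolding eq using Suc fU by auto
    have "real (card (frames n U (Suc k))) = real (\<Sum>vs\<in>frames n U k. card (U k - vec_span n vs))"
      unfolding eq card_image[OF inj] using Suc fU by (subst card_SigmaI) auto
    also have "\<dots> = (\<Sum>vs\<in>frames n U k. real (card (U k)) - real CARD('a) ^ k)"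
      by (simp add: fib)
    finally show ?case using Suc fin by simp
  qed
  then show ?thesis by blast
qed

text \<open>There is no independent list of length \<open>n + 1\<close>, since its span would have more elements than the
whole space. So the product that counts such lists in \<open>K\<close> vanishes, and a vanishing factor says that
the cardinality of \<open>K\<close> is a power of \<open>q\<close>. This replaces the notion of dimension.\<close>
lemma card_subspace:
  fixes K :: "'a::{field,finite} vec set"
  assumes K: "vec_subspace n K"
  obtains m where "m \<le> n" "card K = CARD('a) ^ m"
proof -
  have Kc: "K \<subseteq> carrier_vec n" using K by (auto simp: vec_subspace_def)
  have "frames n (\<lambda>_. K) (Suc n) = {}"
  proof (rule ccontr)
    assume "frames n (\<lambda>_. K) (Suc n) \<noteq> {}"
    then obtain vs where vs: "independent_vecs n vs" "length vs = Suc n" "\<forall>i<Suc n. vs ! i \<in> K"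
      by (auto simp: frames_def)
    have "set vs \<subseteq> K" using vs by (auto simp: in_set_conv_nth)
    then have "vec_span n vs \<subseteq> carrier_vec n" using vec_span_subset[OF K] Kc by blast
    then have "CARD('a) ^ Suc n \<le> CARD('a) ^ n"
      using card_vec_span[OF vs(1)] card_mono[OF finite_carrier_vec]
      by (metis card_carrier_vec vs(2))
    then show False using one_less_card_field[where 'a = 'a] by simp
  qed
  then have "(\<Prod>i<Suc n. real (card K) - real CARD('a) ^ i) = 0"
    using card_frames[of n "\<lambda>_. K" "Suc n"] K by simp
  then obtain i where "i < Suc n" "real (card K) - real CARD('a) ^ i = 0"
    by (auto simp: prod_zero_iff simp del: prod.lessThan_Suc)
  then have "i \<le> n" "card K = CARD('a) ^ i"
    by (simp_all add: of_nat_power[symmetric] del: of_nat_power)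
  then show ?thesis using that by blast
qed

section \<open>Invertible matrices with columns in a subspace\<close>

text \<open>The number of injective linear maps from a space of dimension \<open>k\<close> to a space with \<open>x\<close> elements
over a field with \<open>q\<close> elements.\<close>
definition q_falling :: "real \<Rightarrow> real \<Rightarrow> nat \<Rightarrow> real" where
  "q_falling q x k = (\<Prod>i<k. x - q ^ i)"

lemma q_falling_eq_0: "m < k \<Longrightarrow> q_falling q (q ^ m) k = 0"
  by (auto simp: q_falling_def)

lemma q_falling_pos: "1 < q \<Longrightarrow> k \<le> m \<Longrightarrow> 0 < q_falling q (q ^ m) k"
  unfolding q_falling_def by (intro prod_pos) (auto intro: power_strict_increasing)

lemma prod_lessThan_add:
  fixes f :: "nat \<Rightarrow> 'a::comm_monoid_mult"
  shows "(\<Prod>i<k + m. f i) = (\<Prod>i<k. f i) * (\<Prod>j<m. f (k + j))"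
  by (induction m) (simp_all add: mult.assoc)

lemma q_falling_split:
  "q_falling q (q ^ (k + m)) (k + m) =
     q_falling q (q ^ (k + m)) k * (q ^ (k * m) * q_falling q (q ^ m) m)"
proof -
  have "q_falling q (q ^ (k + m)) (k + m) =
      q_falling q (q ^ (k + m)) k * (\<Prod>j<m. q ^ (k + m) - q ^ (k + j))"
    unfolding q_falling_def by (rule prod_lessThan_add)
  also have "(\<Prod>j<m. q ^ (k + m) - q ^ (k + j)) = (\<Prod>j<m. q ^ k * (q ^ m - q ^ j))"
    by (simp add: power_add algebra_simps)
  also have "\<dots> = q ^ (k * m) * q_falling q (q ^ m) m"
    by (simp add: q_falling_def prod.distrib power_mult)
  finally show ?thesis .
qed

lemma finite_GL: "finite (GL n :: 'a::{field,finite} mat set)"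
  by (rule finite_subset[OF _ finite_carrier_mat[of n n]]) (auto simp: GL_def)

lemma GL_iff_independent_cols:
  fixes g :: "'a::field mat"
  assumes "g \<in> carrier_mat n n"
  shows "g \<in> GL n \<longleftrightarrow> independent_vecs n (cols g)"
proof -
  have "mat_of_cols n (cols g) = g" using assms mat_of_cols_cols[of g] by auto
  moreover have "set (cols g) \<subseteq> carrier_vec n" using assms cols_dim[of g] by auto
  ultimately show ?thesis
    using assms
    by (auto simp: mem_GL_iff_det independent_vecs_def det_0_iff_vec_prod_zero_field)
qed

text \<open>The columns of invertible matrices are exactly the independent lists of length \<open>n\<close>, so this is
a count of frames whose first \<open>k\<close> entries are confined to \<open>K\<close>. Both sides are multiplied by the factor
that belongs to \<open>k\<close> unconfined columns, which avoids a product over \<open>k \<le> i < n\<close> in the statement.\<close>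
lemma card_GL_cols_in_subspace:
  fixes K :: "'a::{field,finite} vec set"
  assumes K: "vec_subspace n K" and k: "k \<le> n"
  shows "real (card {g \<in> GL n. \<forall>i<k. col g i \<in> K}) * q_falling (real CARD('a)) (real CARD('a) ^ n) k
         = q_falling (real CARD('a)) (real (card K)) k * q_falling (real CARD('a)) (real CARD('a) ^ n) n"
proof -
  let ?q = "real CARD('a)"
  define U where "U = (\<lambda>i. if i < k then K else carrier_vec n)"
  have Kc: "K \<subseteq> carrier_vec n" using K by (simp add: vec_subspace_def)
  have "bij_betw cols {g \<in> GL n. \<forall>i<k. col g i \<in> K} (frames n U n)"
  proof (rule bij_betw_byWitness[where f' = "mat_of_cols n"])
    show "\<forall>g\<in>{g \<in> GL n. \<forall>i<k. col g i \<in> K}. mat_of_cols n (cols g) = g"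
    proof
      fix g :: "'a mat" assume "g \<in> {g \<in> GL n. \<forall>i<k. col g i \<in> K}"
      then have "dim_row g = n" by (auto simp: GL_def)
      then show "mat_of_cols n (cols g) = g" using mat_of_cols_cols[of g] by simp
    qed
    show "\<forall>vs\<in>frames n U n. cols (mat_of_cols n vs) = vs"
      by (auto simp: frames_def independent_vecs_def)
    show "cols ` {g \<in> GL n. \<forall>i<k. col g i \<in> K} \<subseteq> frames n U n"
    proof
      fix vs assume "vs \<in> cols ` {g \<in> GL n. \<forall>i<k. col g i \<in> K}"
      then obtain g where g: "vs = cols g" "g \<in> GL n" "\<forall>i<k. col g i \<in> K" by auto
      then have gc: "g \<in> carrier_mat n n" by (auto simp: GL_def)
      have "independent_vecs n (cols g)" using g GL_iff_independent_cols[OF gc] by simp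
      moreover have "cols g ! i \<in> U i" if "i < n" for i
        using that g gc by (auto simp: U_def)
      ultimately show "vs \<in> frames n U n" using g gc by (auto simp: frames_def)
    qed
    show "mat_of_cols n ` frames n U n \<subseteq> {g \<in> GL n. \<forall>i<k. col g i \<in> K}"
    proof
      fix g assume "g \<in> mat_of_cols n ` frames n U n"
      then obtain vs where g: "g = mat_of_cols n vs" and vs: "vs \<in> frames n U n" by auto
      have c: "set vs \<subseteq> carrier_vec n" and l: "length vs = n"
        and i: "independent_vecs n vs" and U: "\<forall>i<n. vs ! i \<in> U i"
        using vs by (auto simp: frames_def independent_vecs_def)
      have gc: "g \<in> carrier_mat n n" using g l by auto
      have cg: "cols g = vs" using c by (simp add: g)
      have "g \<in> GL n" using GL_iff_independent_cols[OF gc] cg i by simp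
      moreover have "col g i \<in> K" if "i < k" for i
      proof -
        have "i < n" using that k by simp
        then have "col g i = cols g ! i" using gc by simp
        also have "\<dots> \<in> U i" using U \<open>i < n\<close> cg by simp
        finally show ?thesis using that by (simp add: U_def)
      qed
      ultimately show "g \<in> {g \<in> GL n. \<forall>i<k. col g i \<in> K}" by simp
    qed
  qed
  then have "real (card {g \<in> GL n. \<forall>i<k. col g i \<in> K}) = real (card (frames n U n))"
    by (simp add: bij_betw_same_card)
  also have "\<dots> = (\<Prod>i<n. real (card (U i)) - ?q ^ i)"
  proof (rule card_frames)
    show "vec_subspace n (U i)" for i using K by (auto simp: U_def vec_subspace_def)
    show "U i \<subseteq> U j" if "i \<le> j" for i j using that Kc by (auto simp: U_def)
  qed
  finally have *: "real (card {g \<in> GL n. \<forall>i<k. col g i \<in> K})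
      = (\<Prod>i<n. real (card (U i)) - ?q ^ i)" .
  have un: "{..<n} = {..<k} \<union> {k..<n}" using k by auto
  have split: "(\<Prod>i<n. f i) = (\<Prod>i<k. f i) * (\<Prod>i=k..<n. f i)" for f :: "nat \<Rightarrow> real"
    unfolding un by (rule prod.union_disjoint) auto
  have "(\<Prod>i<n. real (card (U i)) - ?q ^ i)
      = q_falling ?q (real (card K)) k * (\<Prod>i=k..<n. ?q ^ n - ?q ^ i)"
    unfolding split by (simp add: U_def q_falling_def card_carrier_vec)
  then show ?thesis unfolding * by (simp add: q_falling_def split)
qed

lemma card_GL:
  "real (card (GL n :: 'a::{field,finite} mat set)) =
     q_falling (real CARD('a)) (real CARD('a) ^ n) n"
proof -
  have "vec_subspace n (carrier_vec n :: 'a vec set)" by (auto simp: vec_subspace_def)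
  from card_GL_cols_in_subspace[OF this, of 0] show ?thesis by (simp add: q_falling_def)
qed

lemma card_GL_pos: "0 < real (card (GL n :: 'a::{field,finite} mat set))"
  unfolding card_GL by (rule q_falling_pos[OF one_less_card_field]) simp

section \<open>Matrices with prescribed eigenvectors\<close>

definition eigenspace :: "'a::field mat \<Rightarrow> 'a \<Rightarrow> 'a vec set" where
  "eigenspace A l = {v \<in> carrier_vec (dim_row A). A *\<^sub>v v = l \<cdot>\<^sub>v v}"

definition eigenvalue_free :: "'a::field set \<Rightarrow> nat \<Rightarrow> 'a mat set" where
  "eigenvalue_free S n = {A \<in> carrier_mat n n. \<forall>\<mu>\<in>S. \<not> eigenvalue A \<mu>}"

lemma finite_eigenvalue_free: "finite (eigenvalue_free S n :: 'a::{field,finite} mat set)"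
  by (rule finite_subset[OF _ finite_carrier_mat[of n n]]) (auto simp: eigenvalue_free_def)

lemma vec_subspace_eigenspace:
  assumes "A \<in> carrier_mat n n"
  shows "vec_subspace n (eigenspace A l)"
  unfolding vec_subspace_def
proof (intro conjI ballI allI)
  show "eigenspace A l \<subseteq> carrier_vec n" using assms by (auto simp: eigenspace_def)
  show "0\<^sub>v n \<in> eigenspace A l" using assms by (auto simp: eigenspace_def intro!: eq_vecI)
next
  fix v w assume "v \<in> eigenspace A l" "w \<in> eigenspace A l"
  then show "v + w \<in> eigenspace A l"
    using assms by (auto simp: eigenspace_def mult_add_distrib_mat_vec smult_add_distrib_vec[of _ n])
next
  fix a v assume "v \<in> eigenspace A l"
  then show "a \<cdot>\<^sub>v v \<in> eigenspace A l"
    using assms by (auto simp: eigenspace_def mult_mat_vec smult_smult_assoc mult.commute)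
qed

lemma eigenvalue_iff_card_eigenspace:
  fixes A :: "'a::{field,finite} mat"
  assumes A: "A \<in> carrier_mat n n"
  shows "eigenvalue A l \<longleftrightarrow> card (eigenspace A l) \<noteq> 1"
proof -
  have "0\<^sub>v n \<in> eigenspace A l"
    using vec_subspace_eigenspace[OF A] by (simp add: vec_subspace_def)
  then have "card (eigenspace A l) = 1 \<longleftrightarrow> eigenspace A l = {0\<^sub>v n}"
    by (auto simp: card_1_singleton_iff)
  also have "\<dots> \<longleftrightarrow> \<not> eigenvalue A l"
    using A \<open>0\<^sub>v n \<in> eigenspace A l\<close>
    by (auto simp: eigenvalue_def eigenvector_def eigenspace_def)
  finally show ?thesis by blast
qed

lemma mult_unit_vec_col:
  fixes A :: "'a::comm_ring_1 mat"
  assumes "A \<in> carrier_mat m n" "i < n"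
  shows "A *\<^sub>v unit_vec n i = col A i"
  using col_mult2[OF assms(1) one_carrier_mat assms(2)] assms by simp

lemma eigenvalue_conjugate:
  fixes A :: "'a::field mat"
  assumes "A \<in> carrier_mat n n" "g \<in> carrier_mat n n" "h \<in> carrier_mat n n"
    and "g * h = 1\<^sub>m n" "h * g = 1\<^sub>m n"
  shows "eigenvalue (h * A * g) \<mu> \<longleftrightarrow> eigenvalue A \<mu>"
proof -
  have "similar_mat (h * A * g) A"
    using assms by (intro similar_matI[of _ _ h g n]) auto
  then have "char_poly (h * A * g) = char_poly A" by (rule char_poly_similar)
  moreover have "h * A * g \<in> carrier_mat n n" using assms by auto
  ultimately show ?thesis using eigenvalue_root_char_poly assms(1) by metis
qed

lemma conjugate_prescribed_eigenvectors:
  fixes A :: "'a::field mat"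
  assumes A: "A \<in> carrier_mat n n" and g: "g \<in> carrier_mat n n" and h: "h \<in> carrier_mat n n"
    and hg: "h * g = 1\<^sub>m n" and v: "v \<in> carrier_vec n" and ev: "A *\<^sub>v (g *\<^sub>v v) = l \<cdot>\<^sub>v (g *\<^sub>v v)"
  shows "(h * A * g) *\<^sub>v v = l \<cdot>\<^sub>v v"
proof -
  have gv: "g *\<^sub>v v \<in> carrier_vec n" using g v by simp
  have "(h * A * g) *\<^sub>v v = h *\<^sub>v (A *\<^sub>v (g *\<^sub>v v))"
    using A g h v by (simp add: assoc_mult_mat_vec[of _ n n _ n])
  also have "\<dots> = l \<cdot>\<^sub>v (h *\<^sub>v (g *\<^sub>v v))" using ev mult_mat_vec[OF h gv] by simp
  also have "h *\<^sub>v (g *\<^sub>v v) = v" using assoc_mult_mat_vec[OF h g v] hg v by simp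
  finally show ?thesis .
qed

text \<open>Conjugation by \<open>g\<close> keeps the spectrum and carries the first \<open>k\<close> columns of \<open>g\<close> to the first
\<open>k\<close> unit vectors.\<close>
lemma card_eigenvalue_free_eigenvector_frame:
  fixes g :: "'a::{field,finite} mat"
  assumes gGL: "g \<in> GL n" and k: "k \<le> n"
  shows "card {A \<in> eigenvalue_free S n. \<forall>i<k. col g i \<in> eigenspace A l} =
         card {A \<in> eigenvalue_free S n. \<forall>i<k. unit_vec n i \<in> eigenspace A l}"
proof -
  have g: "g \<in> carrier_mat n n" using gGL by (simp add: GL_def)
  from gGL have "det g \<noteq> 0" using mem_GL_iff_det[OF g] by simp
  from det_non_zero_imp_unit[OF g this, of "()"]
  obtain h where h: "h \<in> carrier_mat n n" and hg: "h * g = 1\<^sub>m n" and gh: "g * h = 1\<^sub>m n"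
    by (auto simp: Units_def ring_mat_def)
  have col: "col g i = g *\<^sub>v unit_vec n i" if "i < k" for i
    using that k g by (simp add: mult_unit_vec_col)
  have inv: "h *\<^sub>v col g i = unit_vec n i" if "i < k" for i
    using col[OF that] assoc_mult_mat_vec[OF h g unit_vec_carrier] hg by (simp add: one_mult_mat_vec)
  have cancel: "h * (g * A * h) * g = A" "g * (h * A * g) * h = A"
    if A: "A \<in> carrier_mat n n" for A
  proof -
    have "h * (g * A * h) * g = (h * g) * A * (h * g)"
      using A g h by (simp add: assoc_mult_mat[of _ n n _ n _ n])
    then show "h * (g * A * h) * g = A" using A hg by simp
    have "g * (h * A * g) * h = (g * h) * A * (g * h)"
      using A g h by (simp add: assoc_mult_mat[of _ n n _ n _ n])
    then show "g * (h * A * g) * h = A" using A gh by simp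
  qed
  have "bij_betw (\<lambda>A. h * A * g)
          {A \<in> eigenvalue_free S n. \<forall>i<k. col g i \<in> eigenspace A l}
          {A \<in> eigenvalue_free S n. \<forall>i<k. unit_vec n i \<in> eigenspace A l}"
  proof (rule bij_betw_byWitness[where f' = "\<lambda>A. g * A * h"])
    show "\<forall>A\<in>{A \<in> eigenvalue_free S n. \<forall>i<k. col g i \<in> eigenspace A l}. g * (h * A * g) * h = A"
      using cancel by (simp add: eigenvalue_free_def)
    show "\<forall>A\<in>{A \<in> eigenvalue_free S n. \<forall>i<k. unit_vec n i \<in> eigenspace A l}. h * (g * A * h) * g = A"
      using cancel by (simp add: eigenvalue_free_def)
    show "(\<lambda>A. h * A * g) ` {A \<in> eigenvalue_free S n. \<forall>i<k. col g i \<in> eigenspace A l}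
          \<subseteq> {A \<in> eigenvalue_free S n. \<forall>i<k. unit_vec n i \<in> eigenspace A l}"
    proof (rule image_subsetI)
      fix A assume *: "A \<in> {A \<in> eigenvalue_free S n. \<forall>i<k. col g i \<in> eigenspace A l}"
      then have A: "A \<in> carrier_mat n n" "\<forall>\<mu>\<in>S. \<not> eigenvalue A \<mu>"
        by (simp_all add: eigenvalue_free_def)
      have ev: "A *\<^sub>v (g *\<^sub>v unit_vec n i) = l \<cdot>\<^sub>v (g *\<^sub>v unit_vec n i)" if "i < k" for i
        using col[OF that] that * by (auto simp: eigenspace_def)
      have "(h * A * g) *\<^sub>v unit_vec n i = l \<cdot>\<^sub>v unit_vec n i" if "i < k" for i
        using conjugate_prescribed_eigenvectors[OF A(1) g h hg unit_vec_carrier ev[OF that]] .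
      then show "h * A * g \<in> {A \<in> eigenvalue_free S n. \<forall>i<k. unit_vec n i \<in> eigenspace A l}"
        using A g h eigenvalue_conjugate[OF A(1) g h gh hg]
        by (auto simp: eigenvalue_free_def eigenspace_def)
    qed
    show "(\<lambda>A. g * A * h) ` {A \<in> eigenvalue_free S n. \<forall>i<k. unit_vec n i \<in> eigenspace A l}
          \<subseteq> {A \<in> eigenvalue_free S n. \<forall>i<k. col g i \<in> eigenspace A l}"
    proof (rule image_subsetI)
      fix A assume *: "A \<in> {A \<in> eigenvalue_free S n. \<forall>i<k. unit_vec n i \<in> eigenspace A l}"
      then have A: "A \<in> carrier_mat n n" "\<forall>\<mu>\<in>S. \<not> eigenvalue A \<mu>"
        by (simp_all add: eigenvalue_free_def)
      have ev: "A *\<^sub>v (h *\<^sub>v col g i) = l \<cdot>\<^sub>v (h *\<^sub>v col g i)" if "i < k" for i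
        using inv[OF that] that * by (auto simp: eigenspace_def)
      have "(g * A * h) *\<^sub>v col g i = l \<cdot>\<^sub>v col g i" if "i < k" for i
        using conjugate_prescribed_eigenvectors[OF A(1) h g gh _ ev[OF that]] col_dim[of g i] g by simp
      then show "g * A * h \<in> {A \<in> eigenvalue_free S n. \<forall>i<k. col g i \<in> eigenspace A l}"
        using A g h eigenvalue_conjugate[OF A(1) h g hg gh]
        by (auto simp: eigenvalue_free_def eigenspace_def)
    qed
  qed
  then show ?thesis by (rule bij_betw_same_card)
qed

lemma eigenvalue_block_scalar:
  fixes C :: "'a::field mat"
  assumes B: "B \<in> carrier_mat k m" and C: "C \<in> carrier_mat m m" and "\<mu> \<noteq> l"
  shows "eigenvalue (four_block_mat (l \<cdot>\<^sub>m 1\<^sub>m k) B (0\<^sub>m m k) C) \<mu> \<longleftrightarrow> eigenvalue C \<mu>"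
proof -
  let ?A = "four_block_mat (l \<cdot>\<^sub>m 1\<^sub>m k) B (0\<^sub>m m k) C"
  have A: "?A \<in> carrier_mat (k + m) (k + m)" using C by auto
  have "char_matrix ?A \<mu> = four_block_mat ((l - \<mu>) \<cdot>\<^sub>m 1\<^sub>m k) B (0\<^sub>m m k) (char_matrix C \<mu>)"
    using B C by (intro eq_matI) (auto simp: char_matrix_def)
  then have "det (char_matrix ?A \<mu>) = (l - \<mu>) ^ k * det (char_matrix C \<mu>)"
    using B C
    by (simp add: det_four_block_mat_lower_left_zero[of _ k _ m] det_smult)
  then show ?thesis
    unfolding eigenvalue_det[OF A] eigenvalue_det[OF C] using assms by simp
qed

text \<open>A matrix that multiplies the first \<open>k\<close> unit vectors by \<open>l\<close> is block triangular, with the scalar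
\<open>l\<close> in the upper left block, an arbitrary upper right block, and a lower right block that carries all
eigenvalues other than \<open>l\<close>.\<close>
lemma card_eigenvalue_free_standard_frame:
  fixes l :: "'a::{field,finite}"
  assumes l: "l \<notin> S"
  shows "card {A \<in> eigenvalue_free S (k + m). \<forall>i<k. unit_vec (k + m) i \<in> eigenspace A l} =
         CARD('a) ^ (k * m) * card (eigenvalue_free S m)"
proof -
  let ?n = "k + m"
  let ?f = "\<lambda>(B, C). four_block_mat (l \<cdot>\<^sub>m 1\<^sub>m k) B (0\<^sub>m m k) C"
  let ?h = "\<lambda>A :: 'a mat. (mat k m (\<lambda>(i,j). A $$ (i, j + k)), mat m m (\<lambda>(i,j). A $$ (i + k, j + k)))"
  let ?X = "{A \<in> eigenvalue_free S ?n. \<forall>i<k. unit_vec ?n i \<in> eigenspace A l}"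
  have fixed: "(\<forall>i<k. unit_vec ?n i \<in> eigenspace A l) \<longleftrightarrow>
      (\<forall>j<k. \<forall>i<?n. A $$ (i, j) = (if i = j then l else 0))"
    if A: "A \<in> carrier_mat ?n ?n" for A :: "'a mat"
  proof -
    have "unit_vec ?n j \<in> eigenspace A l \<longleftrightarrow> (\<forall>i<?n. A $$ (i, j) = (if i = j then l else 0))"
      if "j < k" for j
    proof -
      have "A *\<^sub>v unit_vec ?n j = col A j" using A that by (simp add: mult_unit_vec_col)
      then have "unit_vec ?n j \<in> eigenspace A l \<longleftrightarrow> col A j = l \<cdot>\<^sub>v unit_vec ?n j"
        using A by (auto simp: eigenspace_def)
      also have "\<dots> \<longleftrightarrow> (\<forall>i<?n. A $$ (i, j) = (if i = j then l else 0))"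
        using A that by (auto simp: vec_eq_iff unit_vec_def)
      finally show ?thesis .
    qed
    then show ?thesis by auto
  qed
  have f: "?f (B, C) \<in> carrier_mat ?n ?n" if "C \<in> carrier_mat m m" for B C :: "'a mat"
    using that by auto
  have split: "?f (?h A) = A" if A: "A \<in> ?X" for A
  proof -
    have Ac: "A \<in> carrier_mat ?n ?n" using A by (simp add: eigenvalue_free_def)
    have "\<forall>j<k. \<forall>i<?n. A $$ (i, j) = (if i = j then l else 0)" using A fixed[OF Ac] by simp
    then show ?thesis using Ac by (intro eq_matI) auto
  qed
  have "bij_betw ?f (carrier_mat k m \<times> eigenvalue_free S m) ?X"
  proof (rule bij_betw_byWitness[where f' = ?h])
    show "\<forall>BC\<in>carrier_mat k m \<times> eigenvalue_free S m. ?h (?f BC) = BC"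
      by (auto simp: eigenvalue_free_def intro!: eq_matI)
    show "\<forall>A\<in>?X. ?f (?h A) = A" using split by blast
    show "?f ` (carrier_mat k m \<times> eigenvalue_free S m) \<subseteq> ?X"
    proof (rule image_subsetI)
      fix BC :: "'a mat \<times> 'a mat"
      assume BC': "BC \<in> carrier_mat k m \<times> eigenvalue_free S m"
      obtain B C where p: "BC = (B, C)" by (cases BC)
      then have BC: "B \<in> carrier_mat k m" "C \<in> carrier_mat m m" "\<forall>\<mu>\<in>S. \<not> eigenvalue C \<mu>"
        using BC' by (auto simp: eigenvalue_free_def)
      have "\<not> eigenvalue (?f (B, C)) \<mu>" if "\<mu> \<in> S" for \<mu>
        using eigenvalue_block_scalar[OF BC(1,2), of \<mu> l] that l BC(3) by auto
      moreover have "\<forall>i<k. unit_vec ?n i \<in> eigenspace (?f (B, C)) l"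
        unfolding fixed[OF f[OF BC(2)]] using BC by auto
      ultimately show "?f BC \<in> ?X" using f[OF BC(2)] p by (simp add: eigenvalue_free_def)
    qed
    show "?h ` ?X \<subseteq> carrier_mat k m \<times> eigenvalue_free S m"
    proof (rule image_subsetI)
      fix A assume A: "A \<in> ?X"
      obtain B C where h: "?h A = (B, C)" by (cases "?h A")
      then have BC: "B \<in> carrier_mat k m" "C \<in> carrier_mat m m" by auto
      have "A = ?f (B, C)" using split[OF A] h by metis
      then have "\<not> eigenvalue C \<mu>" if "\<mu> \<in> S" for \<mu>
        using eigenvalue_block_scalar[OF BC, of \<mu> l] that l A by (auto simp: eigenvalue_free_def)
      then show "?h A \<in> carrier_mat k m \<times> eigenvalue_free S m"
        unfolding h using BC by (simp add: eigenvalue_free_def)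
    qed
  qed
  then have "card ?X = card ((carrier_mat k m :: 'a mat set) \<times> eigenvalue_free S m)"
    by (rule bij_betw_same_card[symmetric])
  then show ?thesis by (simp add: card_cartesian_product card_carrier_mat)
qed

text \<open>Double counting of the pairs of a matrix \<open>A\<close> without eigenvalues in \<open>S\<close> and an invertible \<open>g\<close>
whose first \<open>k\<close> columns lie in the eigenspace of \<open>A\<close> for \<open>l\<close>. For fixed \<open>A\<close> the matrices \<open>g\<close> are
counted as frames; for fixed \<open>g\<close> a conjugation reduces the count of \<open>A\<close> to block triangular matrices.
Using all of \<open>g\<close>, and not only its first \<open>k\<close> columns, saves completing independent vectors to
a basis.\<close>
lemma sum_q_falling_eigenspace:
  fixes l :: "'a::{field,finite}"
  assumes l: "l \<notin> S" and k: "k \<le> n"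
  defines "q \<equiv> real CARD('a)"
  shows "(\<Sum>A\<in>eigenvalue_free S n. q_falling q (real (card (eigenspace A l))) k) =
         real (card (GL n :: 'a mat set)) * real (card (eigenvalue_free S (n - k))) /
           real (card (GL (n - k) :: 'a mat set))"
proof -
  obtain m where n: "n = k + m" using k le_Suc_ex by blast
  let ?G = "GL n :: 'a mat set"
  let ?E = "\<lambda>A. {g \<in> ?G. \<forall>i<k. col g i \<in> eigenspace A l}"
  have q: "1 < q" unfolding q_def by (rule one_less_card_field)
  have "(\<Sum>A\<in>eigenvalue_free S n. real (card (?E A))) =
      (\<Sum>A\<in>eigenvalue_free S n. \<Sum>g\<in>?G. of_bool (\<forall>i<k. col g i \<in> eigenspace A l))"
    by (simp add: finite_GL sum_of_bool_eq Int_def)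
  also have "\<dots> = (\<Sum>g\<in>?G. \<Sum>A\<in>eigenvalue_free S n. of_bool (\<forall>i<k. col g i \<in> eigenspace A l))"
    by (rule sum.swap)
  also have "\<dots> = (\<Sum>g\<in>?G. real (card {A \<in> eigenvalue_free S n. \<forall>i<k. col g i \<in> eigenspace A l}))"
    by (simp add: finite_eigenvalue_free sum_of_bool_eq Int_def)
  also have "\<dots> = (\<Sum>g\<in>?G. q ^ (k * m) * real (card (eigenvalue_free S m)))"
    using card_eigenvalue_free_eigenvector_frame[of _ n k S l] card_eigenvalue_free_standard_frame[OF l, of k m] k
    by (intro sum.cong refl) (simp add: n q_def)
  finally have 1: "(\<Sum>A\<in>eigenvalue_free S n. real (card (?E A))) =
      real (card ?G) * (q ^ (k * m) * real (card (eigenvalue_free S m)))" by simp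
  have 2: "real (card (?E A)) * q_falling q (q ^ n) k
      = q_falling q (real (card (eigenspace A l))) k * real (card ?G)" if "A \<in> eigenvalue_free S n" for A
    using card_GL_cols_in_subspace[OF vec_subspace_eigenspace k, of A l] that
    by (simp add: q_def card_GL eigenvalue_free_def)
  have G: "real (card ?G) = q_falling q (q ^ n) k * (q ^ (k * m) * real (card (GL m :: 'a mat set)))"
    using q_falling_split[of q k m] by (simp add: card_GL n q_def)
  have pos: "real (card (GL m :: 'a mat set)) > 0" "real (card ?G) > 0" "q_falling q (q ^ n) k > 0"
    "q ^ (k * m) > 0"
    using q k by (simp_all only: card_GL q_def[symmetric]) (auto intro: q_falling_pos)
  have "(\<Sum>A\<in>eigenvalue_free S n. q_falling q (real (card (eigenspace A l))) k) * real (card ?G)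
      = (\<Sum>A\<in>eigenvalue_free S n. real (card (?E A))) * q_falling q (q ^ n) k"
    by (simp add: sum_distrib_right 2)
  also have "\<dots> = real (card ?G) * (q_falling q (q ^ n) k * q ^ (k * m)) * real (card (eigenvalue_free S m))"
    by (simp add: 1)
  finally have "(\<Sum>A\<in>eigenvalue_free S n. q_falling q (real (card (eigenspace A l))) k)
      = q_falling q (q ^ n) k * q ^ (k * m) * real (card (eigenvalue_free S m))"
    using pos by simp
  also have "\<dots> = real (card ?G) * real (card (eigenvalue_free S m)) / real (card (GL m :: 'a mat set))"
    unfolding G using pos by simp
  finally show ?thesis by (simp add: n)
qed

section \<open>Excluding one eigenvalue\<close>

text \<open>Moebius inversion on the lattice of subspaces: the recursion solves the triangular system that
the weights must satisfy in order that their combination of the numbers \<open>q_falling q (q ^ m) k\<close> picks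
out the zero space. Its solution is \<open>(-1) ^ k * q ^ (k choose 2)\<close> divided by the order of \<open>GL k\<close>.
What matters is that the weights depend neither on the size of the matrices nor on the eigenvalue.\<close>
function moebius_weight :: "real \<Rightarrow> nat \<Rightarrow> real" where
  "moebius_weight q m =
     (of_bool (m = 0) - (\<Sum>k<m. moebius_weight q k * q_falling q (q ^ m) k)) / q_falling q (q ^ m) m"
  by auto
termination by (relation "measure snd") auto

declare moebius_weight.simps [simp del]

lemma sum_moebius_weight:
  assumes "1 < q" "m \<le> n"
  shows "(\<Sum>k\<le>n. moebius_weight q k * q_falling q (q ^ m) k) = of_bool (m = 0)"
proof -
  have "(\<Sum>k\<le>n. moebius_weight q k * q_falling q (q ^ m) k)
      = (\<Sum>k\<le>m. moebius_weight q k * q_falling q (q ^ m) k)"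
    using assms by (intro sum.mono_neutral_right) (auto simp: q_falling_eq_0)
  also have "\<dots> = (\<Sum>k<m. moebius_weight q k * q_falling q (q ^ m) k)
      + moebius_weight q m * q_falling q (q ^ m) m"
    by (simp add: lessThan_Suc_atMost[symmetric])
  also have "\<dots> = of_bool (m = 0)"
    using q_falling_pos[OF assms(1), of m m] by (simp add: moebius_weight.simps[of q m])
  finally show ?thesis .
qed

text \<open>The matrices that avoid \<open>l\<close> as well are those with trivial eigenspace for \<open>l\<close>. The weights turn
this condition into a combination of the counts of independent \<open>k\<close>-tuples of eigenvectors, and
the double counting evaluates each of them. The right-hand side is a convolution.\<close>
lemma card_eigenvalue_free_insert:
  fixes l :: "'a::{field,finite}"
  assumes l: "l \<notin> S"
  shows "real (card (eigenvalue_free (insert l S) n)) / real (card (GL n :: 'a mat set)) =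
     (\<Sum>k\<le>n. moebius_weight (real CARD('a)) k *
        (real (card (eigenvalue_free S (n - k))) / real (card (GL (n - k) :: 'a mat set))))"
proof -
  let ?q = "real CARD('a)"
  let ?c = "moebius_weight ?q"
  let ?E = "\<lambda>A. real (card (eigenspace A l))"
  have q: "1 < ?q" by (rule one_less_card_field)
  have G: "real (card (GL n :: 'a mat set)) > 0"
    by (rule card_GL_pos)
  have ind: "of_bool (\<not> eigenvalue A l) = (\<Sum>k\<le>n. ?c k * q_falling ?q (?E A) k)"
    if "A \<in> eigenvalue_free S n" for A
  proof -
    have A: "A \<in> carrier_mat n n" using that by (simp add: eigenvalue_free_def)
    obtain m where m: "m \<le> n" "card (eigenspace A l) = CARD('a) ^ m"
      using card_subspace[OF vec_subspace_eigenspace[OF A]] .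
    have "eigenvalue A l \<longleftrightarrow> m \<noteq> 0"
      unfolding eigenvalue_iff_card_eigenspace[OF A] m(2) using q by simp
    then show ?thesis using sum_moebius_weight[OF q m(1)] m(2) by simp
  qed
  have "eigenvalue_free (insert l S) n = eigenvalue_free S n \<inter> {A. \<not> eigenvalue A l}"
    by (auto simp: eigenvalue_free_def)
  then have "real (card (eigenvalue_free (insert l S) n)) = (\<Sum>A\<in>eigenvalue_free S n. of_bool (\<not> eigenvalue A l))"
    by (simp add: finite_eigenvalue_free sum_of_bool_eq)
  also have "\<dots> = (\<Sum>A\<in>eigenvalue_free S n. \<Sum>k\<le>n. ?c k * q_falling ?q (?E A) k)"
    by (intro sum.cong refl ind)
  also have "\<dots> = (\<Sum>k\<le>n. ?c k * (\<Sum>A\<in>eigenvalue_free S n. q_falling ?q (?E A) k))"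
    by (subst sum.swap) (simp add: sum_distrib_left)
  also have "\<dots> = (\<Sum>k\<le>n. ?c k * (real (card (GL n :: 'a mat set)) *
      real (card (eigenvalue_free S (n - k))) / real (card (GL (n - k) :: 'a mat set))))"
    by (intro sum.cong refl) (simp add: sum_q_falling_eigenspace[OF l])
  finally show ?thesis using G by (simp add: sum_divide_distrib)
qed

section \<open>Generating functions\<close>

definition weight_gf :: "real \<Rightarrow> real fps" where
  "weight_gf q = Abs_fps (moebius_weight q)"

definition eigenvalue_free_gf :: "'a::{field,finite} set \<Rightarrow> real fps" where
  "eigenvalue_free_gf S = Abs_fps (\<lambda>n. real (card (eigenvalue_free S n)) / real (card (GL n :: 'a mat set)))"

lemma eigenvalue_free_gf_insert:
  fixes l :: "'a::{field,finite}"
  assumes "l \<notin> S"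
  shows "eigenvalue_free_gf (insert l S) = weight_gf (real CARD('a)) * eigenvalue_free_gf S"
  using card_eigenvalue_free_insert[OF assms]
  by (simp add: fps_eq_iff eigenvalue_free_gf_def weight_gf_def fps_mult_nth atLeast0AtMost)

lemma eigenvalue_free_gf_eq_power:
  fixes S :: "'a::{field,finite} set"
  shows "eigenvalue_free_gf S = weight_gf (real CARD('a)) ^ card S * eigenvalue_free_gf ({} :: 'a set)"
proof -
  have "finite S" by simp
  then show ?thesis by (induction S) (simp_all add: eigenvalue_free_gf_insert mult.assoc)
qed

lemma eigenvalue_free_zero: "eigenvalue_free {0} n = (GL n :: 'a::field mat set)"
proof -
  have "eigenvalue A 0 \<longleftrightarrow> det A = 0" if A: "A \<in> carrier_mat n n" for A :: "'a mat"
  proof -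
    have "char_matrix A 0 = A" using A by (intro eq_matI) (auto simp: char_matrix_def)
    then show ?thesis using eigenvalue_det[OF A, of 0] by simp
  qed
  then show ?thesis using mem_GL_iff_det by (auto simp: eigenvalue_free_def GL_def)
qed

lemma eigenvalue_free_gf_zero: "eigenvalue_free_gf {0 :: 'a::{field,finite}} = inverse (1 - fps_X)"
proof -
  have "eigenvalue_free_gf {0 :: 'a} = Abs_fps (\<lambda>n. 1)"
    using card_GL_pos[where 'a = 'a] by (simp add: eigenvalue_free_gf_def eigenvalue_free_zero fps_eq_iff)
  moreover have "inverse (inverse (Abs_fps (\<lambda>n. 1 :: real))) = Abs_fps (\<lambda>n. 1)"
    by (rule fps_inverse_idempotent) simp
  ultimately show ?thesis by (simp add: fps_inverse_gp')
qed

text \<open>The coefficients are \<open>q ^ (n * n)\<close> divided by the order of \<open>GL n\<close>, that is, the reciprocals of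
\<open>(1 - 1/q) * \<dots> * (1 - 1/q ^ n)\<close>. Two consecutive ones differ by the factor \<open>1 - 1/q ^ n\<close>, which is
Euler's \<open>q\<close>-difference equation.\<close>
lemma all_matrices_gf_functional_equation:
  defines "F \<equiv> eigenvalue_free_gf ({} :: 'a::{field,finite} set)"
  shows "(1 - fps_X) * F = F oo (fps_const (1 / real CARD('a)) * fps_X)"
proof (rule fps_ext)
  fix n
  let ?q = "real CARD('a)"
  have q: "1 < ?q" by (rule one_less_card_field)
  have F: "fps_nth F k = ?q ^ (k * k) / q_falling ?q (?q ^ k) k" for k
    by (simp add: F_def eigenvalue_free_gf_def eigenvalue_free_def card_carrier_mat card_GL)
  show "fps_nth ((1 - fps_X) * F) n = fps_nth (F oo (fps_const (1 / ?q) * fps_X)) n"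
  proof (cases n)
    case 0
    then show ?thesis by (simp add: algebra_simps)
  next
    case (Suc m)
    define G where "G = q_falling ?q (?q ^ m) m"
    have G: "G > 0" unfolding G_def using q by (simp add: q_falling_pos)
    have pos: "?q ^ Suc m - 1 > 0" using q one_less_power[of ?q "Suc m"] by simp
    have "q_falling ?q (?q ^ Suc m) (Suc m) = (?q ^ Suc m - 1) * (?q ^ m * G)"
      using q_falling_split[of ?q 1 m] by (simp add: q_falling_def G_def)
    then have FS: "fps_nth F (Suc m) = ?q ^ (Suc m * Suc m) / ((?q ^ Suc m - 1) * (?q ^ m * G))"
      unfolding F by simp
    have alg: "a * b * Q / ((Q - 1) * (b * g)) - a / g = a * b / ((Q - 1) * (b * g))"
      if "Q > 1" "b > 0" "g > 0" for a b Q g :: real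
      using that by (simp add: divide_simps) (simp add: algebra_simps)
    have e: "?q ^ (Suc m * Suc m) = ?q ^ (m * m) * ?q ^ m * ?q ^ Suc m"
      by (simp add: power_add)
    have "fps_nth ((1 - fps_X) * F) n = fps_nth F (Suc m) - fps_nth F m" using Suc by (simp add: algebra_simps)
    also have "\<dots> = ?q ^ (m * m) * ?q ^ m * ?q ^ Suc m / ((?q ^ Suc m - 1) * (?q ^ m * G))
        - ?q ^ (m * m) / G"
      unfolding FS e by (simp add: F G_def)
    also have "\<dots> = ?q ^ (m * m) * ?q ^ m / ((?q ^ Suc m - 1) * (?q ^ m * G))"
      using G pos q by (intro alg) auto
    also have "\<dots> = (1 / ?q) ^ Suc m * fps_nth F (Suc m)"
      unfolding FS e power_divide using q by simp
    finally show ?thesis using Suc by simp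
  qed
qed

text \<open>This is the step from the empty set to the singleton of zero, where the matrices to be counted
are the invertible ones.\<close>
lemma weight_gf_mult_all_matrices_gf:
  "weight_gf (real CARD('a::{field,finite})) * eigenvalue_free_gf ({} :: 'a set) = inverse (1 - fps_X)"
  using eigenvalue_free_gf_insert[of "0 :: 'a" "{}"] by (simp add: eigenvalue_free_gf_zero)

text \<open>Let \<open>F\<close> be the series of all matrices and \<open>W\<close> the weight series. Since \<open>W F = 1 / (1 - u)\<close>, the
functional equation of \<open>F\<close> says that \<open>W(u)\<close> is inverse to \<open>F(u/q)\<close>. Substituting \<open>u/q\<close> for \<open>u\<close> in
this and using the functional equation once more, \<open>(1 - u/q) W(u/q)\<close> is inverse to the same series.\<close>
lemma weight_gf_functional_equation:
  defines "q \<equiv> real CARD('a::{field,finite})"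
  shows "weight_gf q = (1 - fps_const (1 / q) * fps_X) * (weight_gf q oo (fps_const (1 / q) * fps_X))"
proof -
  let ?x = "fps_const (1 / q) * fps_X"
  define W F where "W = weight_gf q" and "F = eigenvalue_free_gf ({} :: 'a set)"
  have dil: "(1 - fps_X) * F = F oo ?x"
    unfolding F_def q_def by (rule all_matrices_gf_functional_equation)
  have "(1 - fps_X) * inverse (1 - fps_X :: real fps) = 1"
    by (simp add: inverse_mult_eq_1')
  then have WF: "W * (F oo ?x) = 1"
    unfolding dil[symmetric] using weight_gf_mult_all_matrices_gf[where 'a = 'a]
    by (simp add: W_def F_def q_def mult.left_commute)
  have "(W oo ?x) * ((1 - fps_X) * F oo ?x) = 1"
  proof -
    have "(W oo ?x) * ((1 - fps_X) * F oo ?x) = W * ((1 - fps_X) * F) oo ?x"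
      by (simp add: fps_compose_mult_distrib)
    also have "\<dots> = 1" unfolding dil WF by simp
    finally show ?thesis .
  qed
  then have "(W oo ?x) * ((1 - ?x) * (F oo ?x)) = 1"
    by (simp add: fps_compose_mult_distrib fps_compose_sub_distrib)
  \<comment> \<open>both \<open>W\<close> and \<open>(1 - ?x) * (W oo ?x)\<close> are inverses of \<open>F oo ?x\<close>\<close>
  then have "W * ((W oo ?x) * ((1 - ?x) * (F oo ?x))) = W" by simp
  then have "(W * (F oo ?x)) * ((1 - ?x) * (W oo ?x)) = W" by (simp only: ac_simps)
  then have "W = (1 - ?x) * (W oo ?x)" by (simp only: WF mult_1)
  then show ?thesis by (simp only: W_def)
qed

lemma weight_gf_finite_product:
  defines "q \<equiv> real CARD('a::{field,finite})"
  shows "weight_gf q = (\<Prod>r=1..N. 1 - fps_const (1 / q ^ r) * fps_X)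
           * (weight_gf q oo (fps_const (1 / q ^ N) * fps_X))"
proof (induction N)
  case 0
  show ?case by (simp add: fps_eq_iff)
next
  case (Suc N)
  let ?W = "weight_gf q" and ?x = "\<lambda>N. fps_const (1 / q ^ N) * fps_X :: real fps"
  have step: "?W = (1 - fps_const (1 / q) * fps_X) * (?W oo (fps_const (1 / q) * fps_X))"
    unfolding q_def by (rule weight_gf_functional_equation)
  have X: "fps_const (1 / q) * fps_X oo ?x N = ?x (Suc N)"
    by (auto simp: fps_eq_iff fps_X_nth le_Suc_eq)
  have x0: "fps_nth (?x N) 0 = 0" by simp
  have "?W oo ?x N = (1 - fps_const (1 / q) * fps_X) * (?W oo (fps_const (1 / q) * fps_X)) oo ?x N"
    using step by simp
  also have "\<dots> = (1 - ?x (Suc N)) * ((?W oo (fps_const (1 / q) * fps_X)) oo ?x N)"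
    by (subst fps_compose_mult_distrib[OF x0])
      (simp only: fps_compose_sub_distrib X fps_compose_1)
  also have "(?W oo (fps_const (1 / q) * fps_X)) oo ?x N = ?W oo ?x (Suc N)"
    by (rule fps_ext) (simp add: power_mult_distrib power_divide)
  finally show ?case using Suc by (simp add: mult.assoc)
qed

text \<open>As the argument of \<open>h\<close> is scaled down, only its constant term survives in the limit.\<close>
lemma tendsto_mult_dilate_nth:
  fixes f h :: "real fps"
  assumes "s \<longlonglongrightarrow> 0"
  shows "(\<lambda>N. fps_nth (f * (h oo (fps_const (s N) * fps_X))) n) \<longlonglongrightarrow> fps_nth f n * fps_nth h 0"
proof -
  have "(\<lambda>N. \<Sum>i=0..n. fps_nth f i * (s N ^ (n - i) * fps_nth h (n - i)))
      \<longlonglongrightarrow> (\<Sum>i=0..n. fps_nth f i * (0 ^ (n - i) * fps_nth h (n - i)))"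
    by (intro tendsto_intros assms)
  also have "(\<Sum>i=0..n. fps_nth f i * (0 ^ (n - i) * fps_nth h (n - i))) = fps_nth f n * fps_nth h 0"
    by (subst sum.remove[of _ n]) (auto intro!: sum.neutral simp: power_0_left)
  finally show ?thesis by (simp add: fps_mult_nth)
qed

text \<open>The finite product differs from the limit by the factor \<open>1 / W(u/q ^ N) ^ p\<close>, whose
coefficients of positive degree tend to zero.\<close>
lemma weight_gf_power_has_prod:
  defines "q \<equiv> real CARD('a::{field,finite})"
  shows "fps_has_prod_coeffwise (\<lambda>r. (1 - fps_const (1 / q ^ r) * fps_X) ^ p) (weight_gf q ^ p)"
  unfolding fps_has_prod_coeffwise_def
proof
  fix n
  let ?x = "\<lambda>N. fps_const (1 / q ^ N) * fps_X :: real fps"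
  define P where "P = weight_gf q ^ p"
  have "moebius_weight q 0 = 1" by (simp add: moebius_weight.simps[of q 0] q_falling_def)
  then have P0: "fps_nth P 0 = 1" by (simp add: P_def weight_gf_def fps_power_zeroth)
  have "(\<Prod>r=1..N. (1 - ?x r) ^ p) = P * (inverse P oo ?x N)" for N
  proof -
    have "P = (\<Prod>r=1..N. 1 - ?x r) ^ p * (weight_gf q oo ?x N) ^ p"
      unfolding P_def q_def
      by (subst weight_gf_finite_product[of N]) (simp add: power_mult_distrib)
    also have "(weight_gf q oo ?x N) ^ p = P oo ?x N"
      unfolding P_def by (rule fps_compose_power) simp
    finally have "P * (inverse P oo ?x N) = (\<Prod>r=1..N. 1 - ?x r) ^ p * ((P * inverse P) oo ?x N)"
      by (simp add: fps_compose_mult_distrib mult.assoc)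
    also have "P * inverse P = 1" using P0 by (intro inverse_mult_eq_1') simp
    finally show ?thesis by (simp add: prod_power_distrib)
  qed
  moreover have "(\<lambda>N. 1 / q ^ N) \<longlonglongrightarrow> 0"
    using one_less_card_field[where 'a = 'a] LIMSEQ_realpow_zero[of "1 / q"]
    by (simp add: q_def power_divide)
  then have "(\<lambda>N. fps_nth (P * (inverse P oo ?x N)) n) \<longlonglongrightarrow> fps_nth P n * fps_nth (inverse P) 0"
    by (rule tendsto_mult_dilate_nth)
  ultimately show "(\<lambda>N. fps_nth (\<Prod>r=1..N. (1 - ?x r) ^ p) n) \<longlonglongrightarrow> fps_nth (weight_gf q ^ p) n"
    using P0 by (simp add: P_def)
qed

lemma projective_derangements_eq_eigenvalue_free:
  "projective_derangements n = (eigenvalue_free UNIV n :: 'a::field mat set)"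
proof -
  have "projective_derangements n \<subseteq> (carrier_mat n n :: 'a mat set)"
    by (auto simp: projective_derangements_def GL_def)
  then show ?thesis using mem_projective_derangements_iff by (auto simp: eigenvalue_free_def)
qed

lemma card_eigenvalue_free_0: "card (eigenvalue_free S 0 :: 'a::{field,finite} mat set) = 1"
proof -
  have "eigenvalue_free S 0 = (carrier_mat 0 0 :: 'a mat set)"
    by (auto simp: eigenvalue_free_def eigenvalue_def eigenvector_def)
  then show ?thesis by (simp add: card_carrier_mat)
qed

theorem theorem12:
  fixes q :: nat and d \<gamma> :: "nat \<Rightarrow> nat"
  assumes "q = CARD('a::{field,finite})"
    and "\<And>n. n \<ge> 1 \<Longrightarrow> d n = card (projective_derangements n :: 'a mat set)"
    and "\<And>n. \<gamma> n = card (GL n :: 'a mat set)"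
  shows "\<exists>P. fps_has_prod_coeffwise (\<lambda>r. (1 - fps_const (1 / real q ^ r) * fps_X) ^ (q - 1)) P \<and>
           1 + Abs_fps (\<lambda>n. if n \<ge> 1 then real (d n) / real (\<gamma> n) else 0) = 1 / (1 - fps_X) * P"
proof (intro exI conjI)
  let ?W = "weight_gf (real q)"
  show "fps_has_prod_coeffwise (\<lambda>r. (1 - fps_const (1 / real q ^ r) * fps_X) ^ (q - 1))
          (?W ^ (q - 1))"
    unfolding assms(1) by (rule weight_gf_power_has_prod)
  have "1 + Abs_fps (\<lambda>n. if n \<ge> 1 then real (d n) / real (\<gamma> n) else 0) = eigenvalue_free_gf (UNIV :: 'a set)"
  proof (rule fps_ext)
    fix n
    show "fps_nth (1 + Abs_fps (\<lambda>n. if n \<ge> 1 then real (d n) / real (\<gamma> n) else 0)) n =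
        fps_nth (eigenvalue_free_gf (UNIV :: 'a set)) n"
    proof (cases n)
      case 0
      have "card (GL 0 :: 'a mat set) = 1"
        using card_eigenvalue_free_0[of "{0 :: 'a}"] by (simp add: eigenvalue_free_zero)
      then show ?thesis using 0 by (simp add: eigenvalue_free_gf_def card_eigenvalue_free_0)
    next
      case (Suc m)
      then show ?thesis
        by (simp add: eigenvalue_free_gf_def assms(2,3) projective_derangements_eq_eigenvalue_free)
    qed
  qed
  also have "\<dots> = ?W ^ q * eigenvalue_free_gf ({} :: 'a set)"
    using eigenvalue_free_gf_eq_power[of "UNIV :: 'a set"] by (simp add: assms(1))
  \<comment> \<open>one of the \<open>q\<close> factors combines with the series of all matrices to \<open>1 / (1 - u)\<close>\<close>
  also have "?W ^ q = ?W ^ (q - 1) * ?W"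
    using one_less_card_field[where 'a = 'a] by (simp add: assms(1) power_eq_if)
  also have "?W ^ (q - 1) * ?W * eigenvalue_free_gf ({} :: 'a set) = ?W ^ (q - 1) * inverse (1 - fps_X)"
    using weight_gf_mult_all_matrices_gf[where 'a = 'a] by (simp add: assms(1) mult.assoc)
  also have "\<dots> = 1 / (1 - fps_X) * ?W ^ (q - 1)"
    by (simp add: fps_divide_unit mult.commute)
  finally show "1 + Abs_fps (\<lambda>n. if n \<ge> 1 then real (d n) / real (\<gamma> n) else 0)
      = 1 / (1 - fps_X) * ?W ^ (q - 1)" .
qed

end
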